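(* If $X \subseteq \omega$ is $2$-generic, then $\mathcal E(X) \leq_{\mathrm{nc}} \mathcal I(X)$ but $\mathcal E(X) \not\leq_{\mathrm{uc}} \mathcal I(X)$.
   Context: For $A \subseteq \omega$ and $n \geq 1$ let $\rho_n(A) = |A \cap [0,n)|/n$; the density $\rho(A)$ is $\lim_n \rho_n(A)$ when it exists. $D$ is a coarse description of $X$ if $\rho(D \triangle X) = 0$. $Y \leq_{\mathrm{uc}} X$ if there is a Turing functional $\Phi$ such that for every coarse description $D$ of $X$, $\Phi^D$ is a coarse description of $Y$. $Y \leq_{\mathrm{nc}} X$ if every coarse description of $X$ computes a coarse description of $Y$. Let $I_n = [n!,(n+1)!)$, $\mathcal I(A) = \bigcup_{n \in A} I_n$, $\mathcal H(A) = \{\langle n,i\rangle : n \in A,\ i \in \omega\}$ (with $\langle\cdot,\cdot\rangle$ a computable pairing function), and $\mathcal E(A) = \mathcal I(\mathcal H(A))$. $X$ is $2$-generic if for every $\Sigma^0_2$ set $S \subseteq 2^{<\omega}$, either some initial segment of $X$ is in $S$, or some initial segment of $X$ has no extension in $S$. *)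

theory Defs
  imports Complex_Main "HOL-Library.Nat_Bijection" "HOL-Library.Sublist"
begin

section \<open>Turing functionals\<close>

text \<open>
  A Turing functional is presented by a program for a partial recursive function relative to an
  oracle: Kleene's partial recursive functions with the characteristic function of the oracle
  added to the initial functions.
\<close>

datatype prog =
    Zero
  | Succ
  | Proj nat
  | Oracle
  | Comp prog "prog list"
  | PrimRec prog prog
  | Mu prog

text \<open>
  \<^term>\<open>None\<close> stands for divergence; a wrong number of arguments also gives \<^term>\<open>None\<close>.
  Composition is strict. In \<open>Mu f\<close> the value \<open>n\<close> is returned only if \<open>f\<close> converges to a nonzero
  value at all \<open>m < n\<close> and to \<open>0\<close> at \<open>n\<close>.
\<close>

primrec eval :: "nat set \<Rightarrow> prog \<Rightarrow> nat list \<Rightarrow> nat option" where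
  "eval A Zero xs = Some 0"
| "eval A Succ xs = (case xs of [x] \<Rightarrow> Some (Suc x) | _ \<Rightarrow> None)"
| "eval A (Proj i) xs = (if i < length xs then Some (xs ! i) else None)"
| "eval A Oracle xs = (case xs of [x] \<Rightarrow> Some (of_bool (x \<in> A)) | _ \<Rightarrow> None)"
| "eval A (Comp f gs) xs =
     (let vs = map (\<lambda>g. eval A g xs) gs
      in if None \<in> set vs then None else eval A f (map the vs))"
| "eval A (PrimRec f g) xs =
     (case xs of
        [] \<Rightarrow> None
      | k # ys \<Rightarrow>
          rec_nat (eval A f ys)
            (\<lambda>n r. case r of None \<Rightarrow> None | Some v \<Rightarrow> eval A g (n # v # ys)) k)"
| "eval A (Mu f) xs =
     (let halts_at = (\<lambda>n. eval A f (n # xs) = Some 0 \<and>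
                          (\<forall>m<n. \<exists>y. eval A f (m # xs) = Some (Suc y)))
      in if \<exists>n. halts_at n then Some (THE n. halts_at n) else None)"

text \<open>\<open>computes \<Phi> D Y\<close> says that \<open>\<Phi>\<close> with oracle \<open>D\<close> is total and is the characteristic
  function of \<open>Y\<close>, i.e. \<open>\<Phi>\<^sup>D = Y\<close>.\<close>

definition computes :: "prog \<Rightarrow> nat set \<Rightarrow> nat set \<Rightarrow> bool" where
  "computes \<Phi> D Y \<longleftrightarrow> (\<forall>n. eval D \<Phi> [n] = Some (of_bool (n \<in> Y)))"


section \<open>Density and coarse reducibilities\<close>

definition partial_density :: "nat \<Rightarrow> nat set \<Rightarrow> real" where
  "partial_density n A = real (card (A \<inter> {0..<n})) / real n"

definition has_density :: "nat set \<Rightarrow> real \<Rightarrow> bool" where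
  "has_density A d \<longleftrightarrow> (\<lambda>n. partial_density n A) \<longlonglongrightarrow> d"

definition coarse_description :: "nat set \<Rightarrow> nat set \<Rightarrow> bool" where
  "coarse_description D X \<longleftrightarrow> has_density (sym_diff D X) 0"

definition uc_le :: "nat set \<Rightarrow> nat set \<Rightarrow> bool" (infix "\<le>\<^sub>u\<^sub>c" 50) where
  "Y \<le>\<^sub>u\<^sub>c X \<longleftrightarrow>
     (\<exists>\<Phi>. \<forall>D. coarse_description D X \<longrightarrow>
        (\<exists>C. computes \<Phi> D C \<and> coarse_description C Y))"

definition nc_le :: "nat set \<Rightarrow> nat set \<Rightarrow> bool" (infix "\<le>\<^sub>n\<^sub>c" 50) where
  "Y \<le>\<^sub>n\<^sub>c X \<longleftrightarrow>
     (\<forall>D. coarse_description D X \<longrightarrow>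
        (\<exists>\<Phi> C. computes \<Phi> D C \<and> coarse_description C Y))"


section \<open>The coding operators\<close>

text \<open>Here \<open>I_block 0\<close> is empty, because \<open>0! = 1!\<close>.\<close>

definition I_block :: "nat \<Rightarrow> nat set" where
  "I_block n = {fact n..<fact (Suc n)}"

definition I_code :: "nat set \<Rightarrow> nat set" where
  "I_code A = (\<Union>n\<in>A. I_block n)"

definition computable_pairing :: "(nat \<Rightarrow> nat \<Rightarrow> nat) \<Rightarrow> bool" where
  "computable_pairing pair \<longleftrightarrow>
     bij (\<lambda>(n, i). pair n i) \<and>
     (\<exists>e. \<forall>n i. eval {} e [n, i] = Some (pair n i))"

definition H_code :: "(nat \<Rightarrow> nat \<Rightarrow> nat) \<Rightarrow> nat set \<Rightarrow> nat set" where
  "H_code pair A = {pair n i | n i. n \<in> A}"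

definition E_code :: "(nat \<Rightarrow> nat \<Rightarrow> nat) \<Rightarrow> nat set \<Rightarrow> nat set" where
  "E_code pair A = I_code (H_code pair A)"

text \<open>The Cantor pairing function of the library is an instance.\<close>

lemma computable_pairing_prod_encode: "computable_pairing (\<lambda>n i. prod_encode (n, i))"
proof -
  define add where "add = PrimRec (Proj 0) (Comp Succ [Proj 1])"
  define tri where "tri = PrimRec Zero (Comp add [Comp Succ [Proj 0], Proj 1])"
  have add: "eval {} add [m, n] = Some (m + n)" for m n
    by (induction m) (simp_all add: add_def)
  have tri: "eval {} tri [n] = Some (triangle n)" for n
    by (induction n) (simp_all add: tri_def add)
  have "eval {} (Comp add [Comp tri [add], Proj 0]) [n, i] = Some (prod_encode (n, i))" for n i
    by (simp add: add tri prod_encode_def)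
  moreover have "bij (\<lambda>(n, i). prod_encode (n, i))"
    using bij_prod_encode by (simp add: case_prod_unfold)
  ultimately show ?thesis
    unfolding computable_pairing_def by blast
qed


section \<open>Generic sets\<close>

text \<open>
  Finite binary strings are Boolean lists, coded injectively, with decidable range, by
  restricting the primitive recursive bijection \<^const>\<open>list_encode\<close>. Computability of the matrix of a \<open>\<Sigma>\<^sup>0\<^sub>2\<close> definition
  is computability with the empty oracle.
\<close>

definition string_code :: "bool list \<Rightarrow> nat" where
  "string_code \<sigma> = list_encode (map of_bool \<sigma>)"

definition computable_matrix :: "(bool list \<Rightarrow> nat \<Rightarrow> nat \<Rightarrow> bool) \<Rightarrow> bool" where
  "computable_matrix R \<longleftrightarrow>
     (\<exists>e. \<forall>\<sigma> a b. eval {} e [string_code \<sigma>, a, b] = Some (of_bool (R \<sigma> a b)))"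

definition Sigma02 :: "bool list set \<Rightarrow> bool" where
  "Sigma02 S \<longleftrightarrow> (\<exists>R. computable_matrix R \<and> S = {\<sigma>. \<exists>a. \<forall>b. R \<sigma> a b})"

definition initial_segment :: "nat set \<Rightarrow> nat \<Rightarrow> bool list" where
  "initial_segment X n = map (\<lambda>i. i \<in> X) [0..<n]"

definition two_generic :: "nat set \<Rightarrow> bool" where
  "two_generic X \<longleftrightarrow>
     (\<forall>S. Sigma02 S \<longrightarrow>
        (\<exists>n. initial_segment X n \<in> S) \<or>
        (\<exists>n. \<forall>\<tau>. prefix (initial_segment X n) \<tau> \<longrightarrow> \<tau> \<notin> S))"

end

theory Submission
  imports Defs
begin

text \<open>
  A coarse description \<open>D\<close> of \<open>\<I>(X)\<close> agrees with it on more than half of \<open>I\<^sub>m\<close> for almost all \<open>m\<close>, so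
  majority votes recover \<open>X\<close> up to finitely many errors; hence \<open>D\<close> computes \<open>X\<close> and \<open>\<E>(X)\<close>, but not
  uniformly.

  Suppose that \<open>\<Phi>\<close> is a uniform reduction. Majority votes on \<open>\<Phi>\<close> with oracle \<open>\<I>(Z)\<close> give a functional
  \<open>\<Psi>\<close> with \<open>\<Psi>\<^sup>Z(n,i) \<rightarrow> X(n)\<close> as \<open>i \<rightarrow> \<infinity>\<close> whenever \<open>Z\<close> is a finite variant of \<open>X\<close>. Apply this to the
  variant \<open>Z\<close> of \<open>X\<close> with bit \<open>n\<close> flipped: for large \<open>i\<close> the value \<open>\<Psi>\<^sup>Z(n,i)\<close> is never \<open>Z(n)\<close>, and by
  genericity of \<open>X\<close> an initial segment of \<open>Z\<close> forces this. As \<open>n\<close> is arbitrary, every initial segment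
  of \<open>X\<close> has an extension in the \<open>\<Sigma>\<^sup>0\<^sub>2\<close> set of strings that force \<open>\<Psi>(n,i)\<close> to miss the \<open>n\<close>-th bit of the
  oracle for some \<open>n\<close> and all large \<open>i\<close>. So \<open>X\<close> meets this set, which contradicts \<open>\<Psi>\<^sup>X(n,i) \<rightarrow> X(n)\<close>.
\<close>

section \<open>Oracle substitution\<close>

text \<open>The predecessor of the successor in the clause for \<open>Oracle\<close> is there for its arity check: \<open>Oracle\<close>
  diverges unless it has exactly one argument, and \<open>p\<close> need not.\<close>

primrec subst_oracle :: "prog \<Rightarrow> prog \<Rightarrow> prog" where
  "subst_oracle p Zero = Zero"
| "subst_oracle p Succ = Succ"
| "subst_oracle p (Proj i) = Proj i"
| "subst_oracle p Oracle = Comp p [Comp (PrimRec Zero (Proj 0)) [Succ]]"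
| "subst_oracle p (Comp f gs) = Comp (subst_oracle p f) (map (subst_oracle p) gs)"
| "subst_oracle p (PrimRec f g) = PrimRec (subst_oracle p f) (subst_oracle p g)"
| "subst_oracle p (Mu f) = Mu (subst_oracle p f)"

lemma eval_subst_oracle:
  assumes "computes p A B"
  shows "eval A (subst_oracle p e) xs = eval B e xs"
proof (induction e arbitrary: xs)
  case Oracle
  have "rec_nat (Some 0) (\<lambda>n. case_option None (\<lambda>v. Some n)) x = Some (x - 1)" for x :: nat
    by (induction x) simp_all
  then show ?case
    using assms by (auto simp: computes_def split: list.split)
next
  case (Comp f gs)
  have "map (\<lambda>g. eval A g xs) (map (subst_oracle p) gs) = map (\<lambda>g. eval B g xs) gs"
    using Comp by simp
  then show ?case
    unfolding subst_oracle.simps eval.simps by (simp only: Comp.IH)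
next
  case (PrimRec f g)
  then show ?case by (simp cong: list.case_cong option.case_cong)
qed simp_all

lemma computes_subst_oracle:
  assumes "computes p A B" "computes q B C"
  shows "computes (subst_oracle p q) A C"
  using assms(2) eval_subst_oracle[OF assms(1)] by (simp add: computes_def)

lemma computes_empty: "computes Zero A {}"
  by (simp add: computes_def)


section \<open>Functions computable uniformly in the oracle\<close>

text \<open>Arguments are the first \<open>k\<close> entries of a sequence, so that a bound variable is a de Bruijn
  index and going under a binder shifts the sequence.\<close>

definition ucomp :: "nat \<Rightarrow> (nat set \<Rightarrow> (nat \<Rightarrow> nat) \<Rightarrow> nat) \<Rightarrow> bool" where
  "ucomp k f \<longleftrightarrow> (\<exists>p. \<forall>A e. eval A p (map e [0..<k]) = Some (f A e))"

named_theorems ucomp_intros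

lemma ucomp_var [ucomp_intros]: "i < k \<Longrightarrow> ucomp k (\<lambda>A e. e i)"
  unfolding ucomp_def by (intro exI[of _ "Proj i"]) simp

lemma eval_Comp_Some:
  assumes "list_all2 (\<lambda>g v. eval A g xs = Some v) gs vs"
  shows "eval A (Comp f gs) xs = eval A f vs"
proof -
  have "map (\<lambda>g. eval A g xs) gs = map Some vs"
    using assms by (induction rule: list_all2_induct) auto
  moreover have "map the (map Some vs) = vs"
    by (simp add: comp_def)
  ultimately show ?thesis
    by (simp add: Let_def image_iff del: map_map)
qed

lemma ucomp_program:
  assumes "ucomp k f"
  obtains p where "\<And>A xs. length xs = k \<Longrightarrow> eval A p xs = Some (f A (\<lambda>i. xs ! i))"
proof -
  obtain p where p: "\<And>A e. eval A p (map e [0..<k]) = Some (f A e)"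
    using assms unfolding ucomp_def by blast
  show thesis
  proof
    fix A and xs :: "nat list"
    assume "length xs = k"
    then have "map (\<lambda>i. xs ! i) [0..<k] = xs"
      using map_nth[of xs] by simp
    then show "eval A p xs = Some (f A (\<lambda>i. xs ! i))"
      using p[of A "\<lambda>i. xs ! i"] by simp
  qed
qed

text \<open>Substitution for all variables at once; renaming, weakening and calls of programs with
  one or two arguments are instances.\<close>

lemma ucomp_sub:
  assumes "ucomp m f" "\<And>i. i < m \<Longrightarrow> ucomp k (h i)"
  shows "ucomp k (\<lambda>A e. f A (\<lambda>i. h i A e))"
proof -
  obtain p where p: "\<And>A e. eval A p (map e [0..<m]) = Some (f A e)"
    using assms(1) unfolding ucomp_def by blast
  have "\<forall>i. \<exists>q. i < m \<longrightarrow> (\<forall>A e. eval A q (map e [0..<k]) = Some (h i A e))"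
    using assms(2) unfolding ucomp_def by blast
  then obtain Q where Q: "\<And>i A e. i < m \<Longrightarrow> eval A (Q i) (map e [0..<k]) = Some (h i A e)"
    by metis
  have "eval A (Comp p (map Q [0..<m])) (map e [0..<k]) = Some (f A (\<lambda>i. h i A e))" for A e
  proof -
    have "eval A (Comp p (map Q [0..<m])) (map e [0..<k]) = eval A p (map (\<lambda>i. h i A e) [0..<m])"
      by (rule eval_Comp_Some) (simp add: list_all2_conv_all_nth Q)
    then show ?thesis by (simp only: p)
  qed
  then show ?thesis unfolding ucomp_def by blast
qed

lemma ucomp_shift:
  assumes "ucomp k f"
  shows "ucomp (k + d) (\<lambda>A e. f A (\<lambda>i. e (i + d)))"
  by (rule ucomp_sub[OF assms]) (rule ucomp_var, simp)

lemma ucomp_call: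
  assumes "\<And>A v. eval A p [v] = Some (F A v)" "ucomp k g"
  shows "ucomp k (\<lambda>A e. F A (g A e))"
proof -
  have "ucomp 1 (\<lambda>A e. F A (e 0))"
    unfolding ucomp_def using assms(1) by (intro exI[of _ p]) simp
  from ucomp_sub[OF this, of k "\<lambda>_. g"] assms(2) show ?thesis by simp
qed

lemma ucomp_call2:
  assumes "\<And>A v w. eval A p [v, w] = Some (F A v w)" "ucomp k g" "ucomp k h"
  shows "ucomp k (\<lambda>A e. F A (g A e) (h A e))"
proof -
  have "ucomp 2 (\<lambda>A e. F A (e 0) (e 1))"
    unfolding ucomp_def using assms(1) by (intro exI[of _ p]) (simp add: upt_rec)
  from ucomp_sub[OF this, of k "\<lambda>i. if i = 0 then g else h"] assms(2,3) show ?thesis by simp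
qed

lemma ucomp_Suc [ucomp_intros]: "ucomp k g \<Longrightarrow> ucomp k (\<lambda>A e. Suc (g A e))"
  by (rule ucomp_call[of Succ]) simp

lemma ucomp_const [ucomp_intros]: "ucomp k (\<lambda>A e. c)"
proof (induction c)
  case 0
  show ?case unfolding ucomp_def by (intro exI[of _ Zero]) simp
qed (rule ucomp_Suc)

lemma ucomp_oracle [ucomp_intros]: "ucomp k g \<Longrightarrow> ucomp k (\<lambda>A e. of_bool (g A e \<in> A))"
  by (rule ucomp_call[of Oracle]) simp

text \<open>\<open>PrimRec\<close> passes the counter and the previous value in front of the
  parameters, so the body sees them as variables 0 and 1, with the parameters shifted by 2.\<close>

lemma ucomp_rec:
  assumes f: "ucomp k f" and g: "ucomp (k + 2) (\<lambda>A e. g A (e 0) (e 1) (\<lambda>i. e (i + 2)))"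
    and t: "ucomp k t"
  shows "ucomp k (\<lambda>A e. rec_nat (f A e) (\<lambda>n r. g A n r e) (t A e))"
proof -
  obtain pf where pf: "\<And>A e. eval A pf (map e [0..<k]) = Some (f A e)"
    using f unfolding ucomp_def by blast
  obtain pt where pt: "\<And>A e. eval A pt (map e [0..<k]) = Some (t A e)"
    using t unfolding ucomp_def by blast
  obtain pg where pg: "\<And>A e. eval A pg (map e [0..<k + 2]) = Some (g A (e 0) (e 1) (\<lambda>i. e (i + 2)))"
    using g unfolding ucomp_def by blast
  have pg': "eval A pg (n # r # map e [0..<k]) = Some (g A n r e)" for A n r e
  proof -
    \<comment> \<open>This is the sequence \<open>e\<close> with \<open>n\<close> and
      \<open>r\<close> put in front.\<close>
    have "map (case_nat n (case_nat r e)) [0..<k + 2] = n # r # map e [0..<k]"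
      by (rule nth_equalityI) (auto simp: nth_Cons split: nat.split simp del: upt_Suc)
    then show ?thesis using pg[of A "case_nat n (case_nat r e)"] by simp
  qed
  have rec: "eval A (PrimRec pf pg) (n # map e [0..<k])
      = Some (rec_nat (f A e) (\<lambda>n r. g A n r e) n)" for A n e
    by (induction n) (simp_all add: pf pg')
  have "eval A (Comp (PrimRec pf pg) (pt # map Proj [0..<k])) (map e [0..<k])
      = Some (rec_nat (f A e) (\<lambda>n r. g A n r e) (t A e))" for A e
  proof -
    have "eval A (Comp (PrimRec pf pg) (pt # map Proj [0..<k])) (map e [0..<k])
      = eval A (PrimRec pf pg) (t A e # map e [0..<k])"
      by (rule eval_Comp_Some) (simp add: pt list.rel_map list_all2_same)
    then show ?thesis by (simp only: rec)
  qed
  then show ?thesis unfolding ucomp_def by blast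
qed

text \<open>\<open>Mu\<close> looks for a zero, hence for the first failure of \<open>g\<close>. A
  failure must exist for every oracle and every sequence because \<open>ucomp\<close> speaks of
  total functions.\<close>

lemma ucomp_Least:
  assumes g: "ucomp (k + 1) (\<lambda>A e. of_bool (g A (e 0) (\<lambda>i. e (i + 1))))"
    and ex: "\<And>A e. \<exists>n. \<not> g A n e"
  shows "ucomp k (\<lambda>A e. LEAST n. \<not> g A n e)"
proof -
  obtain pg where pg: "\<And>A e. eval A pg (map e [0..<k + 1]) = Some (of_bool (g A (e 0) (\<lambda>i. e (i + 1))))"
    using g unfolding ucomp_def by blast
  have pg': "eval A pg (n # map e [0..<k]) = Some (of_bool (g A n e))" for A n e
  proof -
    have "map (case_nat n e) [0..<k + 1] = n # map e [0..<k]"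
      by (rule nth_equalityI) (auto simp: nth_Cons split: nat.split simp del: upt_Suc)
    then show ?thesis using pg[of A "case_nat n e"] by simp
  qed
  have "eval A (Mu pg) (map e [0..<k]) = Some (LEAST n. \<not> g A n e)" for A e
  proof -
    let ?P = "\<lambda>n. \<not> g A n e \<and> (\<forall>m<n. g A m e)"
    have eq: "(eval A pg (n # map e [0..<k]) = Some 0 \<and>
        (\<forall>m<n. \<exists>y. eval A pg (m # map e [0..<k]) = Some (Suc y))) = ?P n" for n
      by (auto simp: pg')
    have least: "?P (LEAST n. \<not> g A n e)"
      using LeastI_ex[OF ex, of A e] not_less_Least by blast
    then have "\<exists>n. ?P n" by (rule exI)
    moreover have "(THE n. ?P n) = (LEAST n. \<not> g A n e)"
      by (rule the_equality[where P = ?P, OF least]) (rule Least_equality[symmetric], auto simp flip: not_less)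
    ultimately show ?thesis unfolding eval.simps Let_def eq by (simp only: if_True)
  qed
  then show ?thesis unfolding ucomp_def by blast
qed

section \<open>Arithmetic, bounded sums and bounded quantifiers\<close>

lemma ucomp_add [ucomp_intros]:
  assumes "ucomp k g" "ucomp k h"
  shows "ucomp k (\<lambda>A e. g A e + h A e)"
proof -
  have "ucomp k (\<lambda>A e. rec_nat (g A e) (\<lambda>n r. Suc r) (h A e))"
    by (intro ucomp_rec ucomp_intros assms) simp
  moreover have "rec_nat a (\<lambda>n r. Suc r) b = a + b" for a b :: nat
    by (induction b) simp_all
  ultimately show ?thesis by simp
qed

lemma ucomp_mult [ucomp_intros]:
  assumes "ucomp k g" "ucomp k h"
  shows "ucomp k (\<lambda>A e. g A e * h A e)"
proof -
  have "ucomp k (\<lambda>A e. rec_nat 0 (\<lambda>n r. r + g A e) (h A e))"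
    by (intro ucomp_rec ucomp_intros assms ucomp_shift) simp_all
  moreover have "rec_nat 0 (\<lambda>n r. r + a) b = a * b" for a b :: nat
    by (induction b) simp_all
  ultimately show ?thesis by simp
qed

lemma ucomp_diff [ucomp_intros]:
  assumes "ucomp k g" "ucomp k h"
  shows "ucomp k (\<lambda>A e. g A e - h A e)"
proof -
  have pred: "ucomp k' (\<lambda>A e. f A e - 1)" if "ucomp k' f" for k' f
  proof -
    have "ucomp k' (\<lambda>A e. rec_nat 0 (\<lambda>n r. n) (f A e))"
      by (intro ucomp_rec ucomp_intros that) simp
    moreover have "rec_nat 0 (\<lambda>n r. n) a = a - 1" for a :: nat
      by (cases a) simp_all
    ultimately show ?thesis by simp
  qed
  have "ucomp k (\<lambda>A e. rec_nat (g A e) (\<lambda>n r. r - 1) (h A e))"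
    by (intro ucomp_rec pred ucomp_intros assms) simp
  moreover have "rec_nat a (\<lambda>n r. r - 1) b = a - b" for a b :: nat
    by (induction b) simp_all
  ultimately show ?thesis by simp
qed

lemma ucomp_sum [ucomp_intros]:
  assumes "ucomp (k + 1) (\<lambda>A e. g A (e 0) (\<lambda>i. e (i + 1)))" "ucomp k t"
  shows "ucomp k (\<lambda>A e. \<Sum>j<t A e. g A j e)"
proof -
  \<comment> \<open>The summand lives under one binder, the recursion under two: the renaming skips
    variable 1, the partial sum.\<close>
  have "ucomp (k + 2) (\<lambda>A e. e (if i = 0 then 0 else i + 1))" if "i < k + 1" for i
    using that by (intro ucomp_var) simp
  from ucomp_sub[OF assms(1), of "k + 2" "\<lambda>i A e. e (if i = 0 then 0 else i + 1)", OF this]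
  have "ucomp (k + 2) (\<lambda>A e. g A (e 0) (\<lambda>i. e (i + 2)))"
    by simp
  then have "ucomp k (\<lambda>A e. rec_nat 0 (\<lambda>n r. r + g A n e) (t A e))"
    by (intro ucomp_rec ucomp_intros assms) simp_all
  moreover have "rec_nat 0 (\<lambda>n r. r + f n) b = (\<Sum>j<b. f j)" for f :: "nat \<Rightarrow> nat" and b
    by (induction b) simp_all
  ultimately show ?thesis by simp
qed

lemma ucomp_not [ucomp_intros]:
  assumes "ucomp k (\<lambda>A e. of_bool (P A e))"
  shows "ucomp k (\<lambda>A e. of_bool (\<not> P A e))"
proof -
  have "ucomp k (\<lambda>A e. 1 - of_bool (P A e))"
    by (intro ucomp_intros assms)
  moreover have "(1 - of_bool (P A e) :: nat) = of_bool (\<not> P A e)" for A e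
    by simp
  ultimately show ?thesis by simp
qed

lemma ucomp_conj [ucomp_intros]:
  assumes "ucomp k (\<lambda>A e. of_bool (P A e))" "ucomp k (\<lambda>A e. of_bool (Q A e))"
  shows "ucomp k (\<lambda>A e. of_bool (P A e \<and> Q A e))"
  using ucomp_mult[OF assms] by (simp add: of_bool_conj)

lemma ucomp_le [ucomp_intros]:
  assumes "ucomp k g" "ucomp k h"
  shows "ucomp k (\<lambda>A e. of_bool (g A e \<le> h A e))"
proof -
  have "ucomp k (\<lambda>A e. 1 - (g A e - h A e))"
    by (intro ucomp_intros assms)
  moreover have "1 - (a - b) = of_bool (a \<le> b)" for a b :: nat
    by simp
  ultimately show ?thesis by simp
qed

lemma ucomp_less [ucomp_intros]:
  assumes "ucomp k g" "ucomp k h"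
  shows "ucomp k (\<lambda>A e. of_bool (g A e < h A e))"
  using ucomp_not[OF ucomp_le[OF assms(2,1)]] by (simp only: not_le)

lemma ucomp_eq [ucomp_intros]:
  assumes "ucomp k g" "ucomp k h"
  shows "ucomp k (\<lambda>A e. of_bool (g A e = h A e))"
  using ucomp_conj[OF ucomp_le[OF assms] ucomp_le[OF assms(2,1)]] by (simp only: eq_iff)

lemma ucomp_iff [ucomp_intros]:
  assumes "ucomp k (\<lambda>A e. of_bool (P A e))" "ucomp k (\<lambda>A e. of_bool (Q A e))"
  shows "ucomp k (\<lambda>A e. of_bool (P A e \<longleftrightarrow> Q A e))"
  using ucomp_eq[OF assms] by (simp only: of_bool_eq_iff)

lemma ucomp_if [ucomp_intros]:
  assumes "ucomp k (\<lambda>A e. of_bool (P A e))" "ucomp k g" "ucomp k h"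
  shows "ucomp k (\<lambda>A e. if P A e then g A e else h A e)"
proof -
  have "ucomp k (\<lambda>A e. of_bool (P A e) * g A e + of_bool (\<not> P A e) * h A e)"
    by (intro ucomp_intros assms)
  moreover have "(of_bool b * x + of_bool (\<not> b) * y :: nat) = (if b then x else y)" for b x y
    by simp
  ultimately show ?thesis by simp
qed

lemma ucomp_ball [ucomp_intros]:
  assumes "ucomp (k + 1) (\<lambda>A e. of_bool (P A (e 0) (\<lambda>i. e (i + 1))))" "ucomp k t"
  shows "ucomp k (\<lambda>A e. of_bool (\<forall>j<t A e. P A j e))"
proof -
  have "ucomp k (\<lambda>A e. of_bool ((\<Sum>j<t A e. of_bool (\<not> P A j e)) = (0::nat)))"
    by (intro ucomp_intros assms)
  moreover have "(\<Sum>j<t A e. of_bool (\<not> P A j e)) = (0::nat) \<longleftrightarrow> (\<forall>j<t A e. P A j e)" for A e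
    by auto
  ultimately show ?thesis by simp
qed

lemma ucomp_fact [ucomp_intros]:
  assumes "ucomp k t"
  shows "ucomp k (\<lambda>A e. fact (t A e))"
proof -
  have "ucomp k (\<lambda>A e. rec_nat 1 (\<lambda>n r. Suc n * r) (t A e))"
    by (intro ucomp_rec ucomp_intros assms) simp_all
  moreover have "rec_nat 1 (\<lambda>n r. Suc n * r) a = fact a" for a
    by (induction a) simp_all
  ultimately show ?thesis by simp
qed

lemma ucomp_lift:
  assumes "ucomp 1 (\<lambda>A e. F A (e 0))" "ucomp k g"
  shows "ucomp k (\<lambda>A e. F A (g A e))"
  using ucomp_sub[OF assms(1), of k "\<lambda>_. g"] assms(2) by simp

section \<open>Decoding of pairs, lists and finite oracles\<close>

lemma ucomp_triangle [ucomp_intros]: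
  assumes "ucomp k t"
  shows "ucomp k (\<lambda>A e. triangle (t A e))"
proof -
  have "ucomp k (\<lambda>A e. \<Sum>j<t A e. Suc j)"
    by (intro ucomp_intros assms) simp
  moreover have "(\<Sum>j<n. Suc j) = triangle n" for n
    by (induction n) simp_all
  ultimately show ?thesis by simp
qed

text \<open>The code is \<open>triangle (m + n) + m\<close>, which is less than
  \<open>triangle (m + n + 1)\<close>. Counting the positive triangular numbers up to the code thus
  recovers the diagonal \<open>m + n\<close>, and both components follow by subtraction.\<close>

lemma diagonal_prod_encode:
  "(\<Sum>k<prod_encode (m, n). of_bool (triangle (Suc k) \<le> prod_encode (m, n))) = m + n"
proof -
  have mono: "triangle i \<le> triangle j" if "i \<le> j" for i j
    using that by (induction j rule: dec_induct) simp_all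
  have "{k. k < prod_encode (m, n) \<and> triangle (Suc k) \<le> prod_encode (m, n)} = {..<m + n}"
  proof (intro set_eqI iffI)
    fix k assume "k \<in> {..<m + n}"
    then have "triangle (Suc k) \<le> triangle (m + n)" by (intro mono) simp
    moreover have "k < triangle (Suc k)" by simp
    ultimately show "k \<in> {k. k < prod_encode (m, n) \<and> triangle (Suc k) \<le> prod_encode (m, n)}"
      unfolding prod_encode_def by simp
  next
    fix k assume k: "k \<in> {k. k < prod_encode (m, n) \<and> triangle (Suc k) \<le> prod_encode (m, n)}"
    show "k \<in> {..<m + n}"
    proof (rule ccontr)
      assume "k \<notin> {..<m + n}"
      then have "triangle (Suc (m + n)) \<le> triangle (Suc k)" by (intro mono) simp
      then show False using k by (simp add: prod_encode_def)
    qed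
  qed
  then show ?thesis
    by (simp add: of_bool_def sum.If_cases Int_def)
qed

lemma ucomp_fst_prod_decode [ucomp_intros]:
  assumes "ucomp k g"
  shows "ucomp k (\<lambda>A e. fst (prod_decode (g A e)))"
    and ucomp_snd_prod_decode: "ucomp k (\<lambda>A e. snd (prod_decode (g A e)))"
proof -
  let ?d = "\<lambda>c::nat. \<Sum>k<c. of_bool (triangle (Suc k) \<le> c)"
  have d: "ucomp k (\<lambda>A e. ?d (g A e))" if "ucomp k g" for k g
    by (rule ucomp_lift[OF _ that]) (intro ucomp_intros; simp)
  have eq: "fst (prod_decode c) = c - triangle (?d c)"
    "snd (prod_decode c) = ?d c - fst (prod_decode c)" for c
  proof -
    obtain m n where c: "c = prod_encode (m, n)"
      by (metis prod_decode_inverse surj_pair)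
    have "?d c = m + n" unfolding c by (rule diagonal_prod_encode)
    moreover have "c = triangle (m + n) + m" "prod_decode c = (m, n)"
      by (simp add: c prod_encode_def, simp add: c)
    ultimately show "fst (prod_decode c) = c - triangle (?d c)"
      "snd (prod_decode c) = ?d c - fst (prod_decode c)"
      by (metis add_diff_cancel_left' fst_conv, metis add_diff_cancel_left' fst_conv snd_conv)
  qed
  show fst: "ucomp k (\<lambda>A e. fst (prod_decode (g A e)))"
    unfolding eq by (intro ucomp_intros d assms)
  show "ucomp k (\<lambda>A e. snd (prod_decode (g A e)))"
    unfolding eq(2) by (intro ucomp_diff fst d assms)
qed

lemmas [ucomp_intros] = ucomp_snd_prod_decode

text \<open>A nonempty list is coded by the successor of the pair of its head and the code of its
  tail, so decrementing and taking the second component removes the head.\<close>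

lemma ucomp_drop_code [ucomp_intros]:
  assumes "ucomp k g" "ucomp k h"
  shows "ucomp k (\<lambda>A e. list_encode (drop (h A e) (list_decode (g A e))))"
proof -
  have "ucomp k (\<lambda>A e. rec_nat (g A e) (\<lambda>n r. snd (prod_decode (r - 1))) (h A e))"
    by (intro ucomp_rec ucomp_intros assms) simp
  moreover have "rec_nat c (\<lambda>n r. snd (prod_decode (r - 1))) j = list_encode (drop j (list_decode c))" for c j
  proof (induction j)
    case (Suc j)
    show ?case
    proof (cases "drop j (list_decode c)")
      case Nil
      moreover have "drop (Suc j) (list_decode c) = []"
        using Nil by simp
      \<comment> \<open>The empty list has code 0, and truncated subtraction keeps it at 0, so the
        iteration stays at the empty list.\<close>
      moreover have "prod_decode 0 = (0, 0)"
        by (simp add: prod_decode_def prod_decode_aux.simps)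
      ultimately show ?thesis using Suc by simp
    next
      case (Cons x xs)
      moreover have "drop (Suc j) (list_decode c) = xs"
        using Cons by (metis drop_Suc list.sel(3) tl_drop)
      ultimately show ?thesis using Suc by simp
    qed
  qed simp
  ultimately show ?thesis by simp
qed

lemma length_le_list_encode: "length xs \<le> list_encode xs"
proof (induction xs)
  case (Cons x xs)
  then show ?case using le_prod_encode_2[of "list_encode xs" x] by simp
qed simp

lemma list_encode_eq_0_iff: "list_encode xs = 0 \<longleftrightarrow> xs = []"
  by (cases xs) simp_all

text \<open>The length counts the \<open>j\<close> for which dropping \<open>j\<close> entries
  leaves a nonzero code; the code itself bounds the length and hence the range of the count.\<close>

lemma ucomp_length_list_decode [ucomp_intros]:
  assumes "ucomp k g"
  shows "ucomp k (\<lambda>A e. length (list_decode (g A e)))"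
proof -
  have "ucomp k (\<lambda>A e. (\<lambda>c. \<Sum>j<c. of_bool (list_encode (drop j (list_decode c)) \<noteq> 0)) (g A e))"
    by (rule ucomp_lift[OF _ assms]) (intro ucomp_intros; simp)
  moreover have "(\<Sum>j<c. of_bool (list_encode (drop j (list_decode c)) \<noteq> 0)) = length (list_decode c)" for c
  proof -
    have "{j. j < c \<and> list_encode (drop j (list_decode c)) \<noteq> 0} = {..<length (list_decode c)}"
      using length_le_list_encode[of "list_decode c"] by (auto simp: list_encode_eq_0_iff)
    then show ?thesis
      by (simp add: of_bool_def sum.If_cases Int_def)
  qed
  ultimately show ?thesis by simp
qed

text \<open>Every number codes a finite oracle in this way, not only the values of
  \<open>string_code\<close>, so a quantifier over finite oracles becomes one over numbers.\<close>

definition code_set :: "nat \<Rightarrow> nat set" where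
  "code_set c = {x. x < length (list_decode c) \<and> list_decode c ! x \<noteq> 0}"

lemma ucomp_code_set [ucomp_intros]:
  assumes "ucomp k g" "ucomp k h"
  shows "ucomp k (\<lambda>A e. of_bool (h A e \<in> code_set (g A e)))"
proof -
  have "ucomp k (\<lambda>A e. of_bool (fst (prod_decode (list_encode (drop (h A e) (list_decode (g A e))) - 1)) \<noteq> 0))"
    by (intro ucomp_intros assms)
  moreover have "fst (prod_decode (list_encode (drop x (list_decode c)) - 1)) \<noteq> 0 \<longleftrightarrow> x \<in> code_set c" for x c
  proof (cases "x < length (list_decode c)")
    case True
    then show ?thesis by (simp add: code_set_def flip: Cons_nth_drop_Suc)
  next
    case False
    \<comment> \<open>Beyond the end the remaining list has code 0, whose default head 0 reads as
      non-membership.\<close>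
    moreover have "prod_decode 0 = (0, 0)"
      by (simp add: prod_decode_def prod_decode_aux.simps)
    ultimately show ?thesis by (simp add: code_set_def)
  qed
  ultimately show ?thesis by simp
qed

lemma length_string_code [simp]: "length (list_decode (string_code \<sigma>)) = length \<sigma>"
  by (simp add: string_code_def)

lemma mem_code_set_string_code [simp]: "x \<in> code_set (string_code \<sigma>) \<longleftrightarrow> x < length \<sigma> \<and> \<sigma> ! x"
  by (auto simp: code_set_def string_code_def)


section \<open>Computations with finite oracles\<close>

text \<open>Oracle queries and unbounded searches are cut off at \<open>L\<close>, which makes the evaluation
  computable in a finite oracle. The value \<open>0\<close> means undefined, \<open>Suc v\<close> means \<open>v\<close>.\<close>

primrec approx :: "nat \<Rightarrow> nat set \<Rightarrow> prog \<Rightarrow> nat list \<Rightarrow> nat" where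
  "approx L B Zero xs = 1"
| "approx L B Succ xs = (case xs of [x] \<Rightarrow> Suc (Suc x) | _ \<Rightarrow> 0)"
| "approx L B (Proj i) xs = (if i < length xs then Suc (xs ! i) else 0)"
| "approx L B Oracle xs = (case xs of [x] \<Rightarrow> if x < L then Suc (of_bool (x \<in> B)) else 0 | _ \<Rightarrow> 0)"
| "approx L B (Comp f gs) xs =
     (let vs = map (\<lambda>g. approx L B g xs) gs
      in if 0 \<in> set vs then 0 else approx L B f (map (\<lambda>v. v - 1) vs))"
| "approx L B (PrimRec f g) xs =
     (case xs of
        [] \<Rightarrow> 0
      | k # ys \<Rightarrow>
          rec_nat (approx L B f ys)
            (\<lambda>n r. if r = 0 then 0 else approx L B g (n # (r - 1) # ys)) k)"
| "approx L B (Mu f) xs =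
     rec_nat 0
       (\<lambda>n s. if s \<noteq> 0 then s
              else if approx L B f (n # xs) = 0 then 1
              else if approx L B f (n # xs) = 1 then n + 2
              else 0) L - 1"

text \<open>\<open>s\<close> is the state of the search in \<open>approx\<close>: 0 while all values
  so far are defined and nonzero, 1 after an undefined value, \<open>n + 2\<close> once
  \<open>n\<close> is found. Subtracting 1 turns the state into a result as coded in
  \<open>approx\<close>.\<close>

lemma bounded_search:
  fixes y :: "nat \<Rightarrow> nat"
  defines "s \<equiv> rec_nat 0 (\<lambda>n s. if s \<noteq> 0 then s else if y n = 0 then 1 else if y n = 1 then n + 2 else 0)"
  shows "s L = Suc (Suc n) \<longleftrightarrow> n < L \<and> y n = 1 \<and> (\<forall>m<n. 1 < y m)"
proof -
  have zero: "s L = 0 \<longleftrightarrow> (\<forall>m<L. 1 < y m)" for L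
    by (induction L) (auto simp: s_def less_Suc_eq)
  show ?thesis
  proof (induction L)
    case 0
    show ?case by (simp add: s_def)
  next
    case (Suc L)
    have step: "s (Suc L) = (if s L \<noteq> 0 then s L else if y L = 0 then 1 else if y L = 1 then L + 2 else 0)"
      by (simp add: s_def)
    show ?case
    proof (cases "s L = 0")
      case True
      then have "\<forall>m<L. 1 < y m" using zero[of L] by simp
      then show ?thesis using True step by (auto simp: less_Suc_eq)
    next
      case False
      then have eq: "s (Suc L) = s L" using step by simp
      have "\<not> (\<forall>m<L. 1 < y m)" using False zero[of L] by simp
      then have "n < L \<and> y n = 1 \<and> (\<forall>m<n. 1 < y m) \<longleftrightarrow> n < Suc L \<and> y n = 1 \<and> (\<forall>m<n. 1 < y m)"
        by (cases "n = L") (simp_all only: less_Suc_eq simp_thms)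
      then show ?thesis unfolding eq Suc .
    qed
  qed
qed

lemma search_unique:
  assumes "eval A f (n # xs) = Some 0 \<and> (\<forall>m<n. \<exists>y. eval A f (m # xs) = Some (Suc y))"
    and "eval A f (n' # xs) = Some 0 \<and> (\<forall>m<n'. \<exists>y. eval A f (m # xs) = Some (Suc y))"
  shows "n = n'"
proof (rule linorder_cases[of n n'])
  assume "n < n'"
  then obtain y where "eval A f (n # xs) = Some (Suc y)" using assms(2) by blast
  then show ?thesis using assms(1) by simp
next
  assume "n' < n"
  then obtain y where "eval A f (n' # xs) = Some (Suc y)" using assms(1) by blast
  then show ?thesis using assms(2) by simp
qed

text \<open>Use principle: a convergent truncated computation has only queried numbers below
  \<open>L\<close>, so it is a true computation for every oracle that agrees with \<open>B\<close>
  there.\<close>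

lemma approx_sound:
  assumes "\<And>x. x < L \<Longrightarrow> x \<in> A \<longleftrightarrow> x \<in> B"
  shows "approx L B p xs = Suc v \<Longrightarrow> eval A p xs = Some v"
proof (induction p arbitrary: xs v)
  case Oracle
  then show ?case using assms by (auto split: list.splits if_splits)
next
  case (Comp f gs)
  let ?vs = "map (\<lambda>g. approx L B g xs - 1) gs"
  from Comp.prems have nz: "\<forall>g\<in>set gs. approx L B g xs \<noteq> 0"
    and f: "approx L B f ?vs = Suc v"
    by (auto simp: Let_def image_iff comp_def split: if_splits)
  have "eval A (Comp f gs) xs = eval A f ?vs"
    by (rule eval_Comp_Some)
      (use nz Comp.IH(2) in \<open>force simp: list.rel_map list_all2_same\<close>)
  then show ?case using Comp.IH(1)[OF f] by simp
next
  case (PrimRec f g)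
  show ?case
  proof (cases xs)
    case (Cons k ys)
    have "rec_nat (approx L B f ys) (\<lambda>n r. if r = 0 then 0 else approx L B g (n # (r - 1) # ys)) k = Suc v
      \<Longrightarrow> rec_nat (eval A f ys) (\<lambda>n r. case r of None \<Rightarrow> None | Some v \<Rightarrow> eval A g (n # v # ys)) k = Some v"
    proof (induction k arbitrary: v)
      case 0
      then show ?case using PrimRec.IH(1) by simp
    next
      case (Suc k)
      then have "rec_nat (approx L B f ys) (\<lambda>n r. if r = 0 then 0 else approx L B g (n # (r - 1) # ys)) k \<noteq> 0"
        by (auto split: if_splits)
      then obtain w where
        "rec_nat (approx L B f ys) (\<lambda>n r. if r = 0 then 0 else approx L B g (n # (r - 1) # ys)) k = Suc w"
        using not0_implies_Suc by blast
      then show ?case using Suc PrimRec.IH(2) by simp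
    qed
    then show ?thesis using PrimRec.prems Cons by simp
  qed (use PrimRec.prems in simp)
next
  case (Mu f)
  from Mu.prems have v: "approx L B f (v # xs) = 1" "\<forall>m<v. 1 < approx L B f (m # xs)"
    using bounded_search[of "\<lambda>n. approx L B f (n # xs)" L v] by auto
  have f: "eval A f (v # xs) = Some 0" using v(1) Mu.IH by simp
  have lt: "\<exists>y. eval A f (m # xs) = Some (Suc y)" if "m < v" for m
  proof -
    have "1 < approx L B f (m # xs)" using v(2) that by blast
    then have "approx L B f (m # xs) = Suc (Suc (approx L B f (m # xs) - 2))" by simp
    then show ?thesis using Mu.IH by blast
  qed
  have "\<exists>n. eval A f (n # xs) = Some 0 \<and> (\<forall>m<n. \<exists>y. eval A f (m # xs) = Some (Suc y))"
    using f lt by blast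
  moreover have "(THE n. eval A f (n # xs) = Some 0 \<and> (\<forall>m<n. \<exists>y. eval A f (m # xs) = Some (Suc y))) = v"
    using f lt by (intro the_equality search_unique[where f = f and xs = xs and A = A]) blast+
  ultimately show ?case
    unfolding eval.simps Let_def by (simp only: if_True)
qed (auto split: list.splits if_splits)

text \<open>A halting computation makes finitely many queries and search steps, so every large
  cut-off admits it. The form with \<open>eventually\<close> lets the bounds of finitely many
  subcomputations be combined.\<close>

lemma approx_complete:
  "eval A p xs = Some v \<Longrightarrow> \<forall>\<^sub>F L in sequentially. approx L A p xs = Suc v"
proof (induction p arbitrary: xs v)
  case Oracle
  then obtain x where "xs = [x]" "v = of_bool (x \<in> A)"
    by (auto split: list.splits)
  then show ?case
    using eventually_gt_at_top[of x] by (auto elim!: eventually_mono)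
next
  case (Comp f gs)
  let ?vs = "map (\<lambda>g. the (eval A g xs)) gs"
  from Comp.prems have nz: "\<forall>g\<in>set gs. None \<noteq> eval A g xs" and f: "eval A f ?vs = Some v"
    by (auto simp: Let_def image_iff comp_def split: if_splits)
  have "\<forall>\<^sub>F L in sequentially. \<forall>g\<in>set gs. approx L A g xs = Suc (the (eval A g xs))"
  proof (intro eventually_ball_finite ballI)
    fix g assume g: "g \<in> set gs"
    then have "eval A g xs = Some (the (eval A g xs))"
      using nz by (metis option.collapse)
    then show "\<forall>\<^sub>F L in sequentially. approx L A g xs = Suc (the (eval A g xs))"
      by (rule Comp.IH(2)[OF g])
  qed simp
  with Comp.IH(1)[OF f] show ?case
  proof eventually_elim
    case (elim L)
    have eq: "map (\<lambda>g. approx L A g xs) gs = map Suc ?vs" "map (\<lambda>v. v - 1) (map Suc ?vs) = ?vs"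
      using elim(2) by simp_all
    show ?case
      using elim(1) unfolding approx.simps Let_def eq by (simp only:) auto
  qed
next
  case (PrimRec f g)
  show ?case
  proof (cases xs)
    case (Cons k ys)
    have "rec_nat (eval A f ys) (\<lambda>n r. case r of None \<Rightarrow> None | Some v \<Rightarrow> eval A g (n # v # ys)) k = Some v
      \<Longrightarrow> \<forall>\<^sub>F L in sequentially.
        rec_nat (approx L A f ys) (\<lambda>n r. if r = 0 then 0 else approx L A g (n # (r - 1) # ys)) k = Suc v"
    proof (induction k arbitrary: v)
      case 0
      then show ?case using PrimRec.IH(1) by simp
    next
      case (Suc k)
      then obtain w where w:
        "rec_nat (eval A f ys) (\<lambda>n r. case r of None \<Rightarrow> None | Some v \<Rightarrow> eval A g (n # v # ys)) k = Some w"
        "eval A g (k # w # ys) = Some v"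
        by (auto split: option.splits)
      from Suc.IH[OF w(1)] PrimRec.IH(2)[OF w(2)] show ?case
        by eventually_elim simp
    qed
    then show ?thesis using PrimRec.prems Cons by simp
  qed (use PrimRec.prems in simp)
next
  case (Mu f)
  let ?P = "\<lambda>n. eval A f (n # xs) = Some 0 \<and> (\<forall>m<n. \<exists>y. eval A f (m # xs) = Some (Suc y))"
  from Mu.prems obtain n where n: "?P n" "v = (THE n. ?P n)"
    by (auto simp: Let_def split: if_splits)
  have "(THE n. ?P n) = n"
    using n(1) by (intro the_equality search_unique[where f = f and xs = xs and A = A])
  with n have v: "?P v" by simp
  have "\<forall>\<^sub>F L in sequentially. \<forall>m\<in>{..<v}. 1 < approx L A f (m # xs)"
  proof (intro eventually_ball_finite ballI)
    fix m assume "m \<in> {..<v}"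
    then obtain y where "eval A f (m # xs) = Some (Suc y)" using v by auto
    from Mu.IH[OF this] show "\<forall>\<^sub>F L in sequentially. 1 < approx L A f (m # xs)"
      by eventually_elim simp
  qed simp
  moreover have "\<forall>\<^sub>F L in sequentially. approx L A f (v # xs) = 1"
    using Mu.IH[of "v # xs" 0] v by simp
  ultimately show ?case
    using eventually_gt_at_top[of v]
  proof eventually_elim
    case (elim L)
    then show ?case
      using bounded_search[of "\<lambda>n. approx L A f (n # xs)" L v] by simp
  qed
qed (auto split: list.splits if_splits)

lemma approx_cong:
  assumes "\<And>x. x < L \<Longrightarrow> x \<in> A \<longleftrightarrow> x \<in> B"
  shows "approx L A p xs = approx L B p xs"
proof (induction p arbitrary: xs)
  case Oracle
  then show ?case using assms by (auto split: list.split)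
next
  case (Comp f gs)
  have "map (\<lambda>g. approx L A g xs) gs = map (\<lambda>g. approx L B g xs) gs"
    using Comp by simp
  then show ?case
    unfolding approx.simps by (simp only: Comp.IH)
next
  case (PrimRec f g)
  then show ?case by (simp cong: list.case_cong if_cong)
qed (simp_all cong: if_cong)

section \<open>Computability of the truncated evaluation\<close>

lemma ucomp_zero_mem_map:
  assumes "list_all (ucomp k) gs"
  shows "ucomp k (\<lambda>A e. of_bool (0 \<in> set (map (\<lambda>g. g A e) gs)))"
  using assms
proof (induction gs)
  case (Cons g gs)
  then have "ucomp k (\<lambda>A e. of_bool (\<not> (\<not> g A e = 0 \<and> \<not> 0 \<in> set (map (\<lambda>g. g A e) gs))))"
    by (intro ucomp_intros) simp_all
  moreover have "(\<not> (\<not> g A e = 0 \<and> \<not> 0 \<in> set (map (\<lambda>g. g A e) gs)))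
      = (0 \<in> set (map (\<lambda>g. g A e) (g # gs)))" for A e
    by auto
  ultimately show ?case by (simp only:)
qed (simp add: ucomp_const)

lemma list_all_ucomp_shift:
  "list_all (ucomp k) gs \<Longrightarrow> list_all (ucomp (k + d)) (map (\<lambda>g A e. g A (\<lambda>i. e (i + d))) gs)"
  by (auto simp: list_all_iff intro: ucomp_shift)

text \<open>Induction on the fixed program \<open>p\<close>: each constructor is matched by a
  closure property of \<open>ucomp\<close>. The finite oracle enters through its code
  \<open>c\<close>, which may be a variable; \<open>k\<close>, \<open>c\<close> and
  \<open>gs\<close> vary in the induction because recursion and search add two variables.\<close>

lemma ucomp_approx:
  assumes "ucomp k c" "list_all (ucomp k) gs"
  shows "ucomp k (\<lambda>A e. approx (length (list_decode (c A e))) (code_set (c A e)) p (map (\<lambda>g. g A e) gs))"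
  using assms
proof (induction p arbitrary: k c gs)
  case Zero
  show ?case unfolding approx.simps by (rule ucomp_const)
next
  case Succ
  then show ?case
  proof (cases gs)
    case (Cons g gs')
    then show ?thesis
      using Succ by (cases gs') (auto intro!: ucomp_intros)
  qed (simp add: ucomp_const)
next
  case (Proj i)
  show ?case
  proof (cases "i < length gs")
    case True
    then have "ucomp k (\<lambda>A e. Suc ((gs ! i) A e))"
      using Proj by (intro ucomp_Suc) (simp add: list_all_length)
    then show ?thesis using True by simp
  qed (simp add: ucomp_const)
next
  case Oracle
  then show ?case
  proof (cases gs)
    case (Cons g gs')
    then show ?thesis
      using Oracle by (cases gs') (auto intro!: ucomp_intros)
  qed (simp add: ucomp_const)
next
  case (Comp f hs)
  let ?a = "\<lambda>p A e. approx (length (list_decode (c A e))) (code_set (c A e)) p (map (\<lambda>g. g A e) gs)"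
  have hs: "list_all (ucomp k) (map ?a hs)"
    using Comp by (simp add: list_all_iff)
  have "ucomp k (\<lambda>A e. if 0 \<in> set (map (\<lambda>g. g A e) (map ?a hs)) then 0
    else approx (length (list_decode (c A e))) (code_set (c A e)) f
      (map (\<lambda>g. g A e) (map (\<lambda>h A e. ?a h A e - 1) hs)))"
  proof (intro ucomp_if ucomp_zero_mem_map hs ucomp_const Comp.IH(1) Comp.prems(1))
    show "list_all (ucomp k) (map (\<lambda>h A e. ?a h A e - 1) hs)"
      using hs by (auto simp: list_all_iff intro!: ucomp_diff ucomp_const)
  qed
  then show ?case unfolding approx.simps Let_def map_map comp_def .
next
  case (PrimRec f g)
  show ?case
  proof (cases gs)
    case Nil
    then show ?thesis by (simp add: ucomp_const)
  next
    case (Cons h ys)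
    let ?a = "\<lambda>p A e xs. approx (length (list_decode (c A e))) (code_set (c A e)) p xs"
    have prems: "ucomp k c" "ucomp k h" "list_all (ucomp k) ys"
      using PrimRec.prems Cons by simp_all
    have "ucomp k (\<lambda>A e. rec_nat (?a f A e (map (\<lambda>g. g A e) ys))
      (\<lambda>n r. if r = 0 then 0 else ?a g A e (n # (r - 1) # map (\<lambda>g. g A e) ys)) (h A e))"
    proof (intro ucomp_rec PrimRec.IH(1) prems)
      have "ucomp (k + 2) (\<lambda>A e. ?a g A (\<lambda>i. e (i + 2)) (map (\<lambda>g. g A e)
        ((\<lambda>A e. e 0) # (\<lambda>A e. e 1 - 1) # map (\<lambda>g A e. g A (\<lambda>i. e (i + 2))) ys)))"
      proof (intro PrimRec.IH(2))
        show "ucomp (k + 2) (\<lambda>A e. c A (\<lambda>i. e (i + 2)))"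
          by (intro ucomp_shift prems)
        show "list_all (ucomp (k + 2)) ((\<lambda>A e. e 0) # (\<lambda>A e. e 1 - 1) # map (\<lambda>g A e. g A (\<lambda>i. e (i + 2))) ys)"
          unfolding list.pred_inject
          by (intro conjI list_all_ucomp_shift prems ucomp_diff ucomp_const ucomp_var) simp_all
      qed
      then have "ucomp (k + 2) (\<lambda>A e. if e 1 = 0 then 0 else ?a g A (\<lambda>i. e (i + 2)) (map (\<lambda>g. g A e)
        ((\<lambda>A e. e 0) # (\<lambda>A e. e 1 - 1) # map (\<lambda>g A e. g A (\<lambda>i. e (i + 2))) ys)))"
        by (intro ucomp_if ucomp_eq ucomp_const ucomp_var) simp_all
      then show "ucomp (k + 2) (\<lambda>A e. if e 1 = 0 then 0 else ?a g A (\<lambda>i. e (i + 2))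
          (e 0 # (e 1 - 1) # map (\<lambda>g. g A (\<lambda>i. e (i + 2))) ys))"
        unfolding list.map map_map comp_def .
    qed
    then show ?thesis by (simp add: Cons)
  qed
next
  case (Mu f)
  let ?a = "\<lambda>A e xs. approx (length (list_decode (c A e))) (code_set (c A e)) f xs"
  have "ucomp (k + 2) (\<lambda>A e. ?a A (\<lambda>i. e (i + 2)) (map (\<lambda>g. g A e)
        ((\<lambda>A e. e 0) # map (\<lambda>g A e. g A (\<lambda>i. e (i + 2))) gs)))"
  proof (intro Mu.IH)
    show "ucomp (k + 2) (\<lambda>A e. c A (\<lambda>i. e (i + 2)))"
      by (intro ucomp_shift Mu.prems)
    show "list_all (ucomp (k + 2)) ((\<lambda>A e. e 0) # map (\<lambda>g A e. g A (\<lambda>i. e (i + 2))) gs)"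
      unfolding list.pred_inject
      by (intro conjI list_all_ucomp_shift Mu.prems ucomp_var) simp
  qed
  then have step: "ucomp (k + 2) (\<lambda>A e. ?a A (\<lambda>i. e (i + 2)) (e 0 # map (\<lambda>g. g A (\<lambda>i. e (i + 2))) gs))"
    unfolding list.map map_map comp_def .
  have "ucomp k (\<lambda>A e. rec_nat 0
       (\<lambda>n s. if s \<noteq> 0 then s
              else if ?a A e (n # map (\<lambda>g. g A e) gs) = 0 then 1
              else if ?a A e (n # map (\<lambda>g. g A e) gs) = 1 then n + 2
              else 0) (length (list_decode (c A e))) - 1)"
    by (intro ucomp_rec ucomp_if ucomp_not ucomp_eq ucomp_diff ucomp_add ucomp_const ucomp_var step
        ucomp_length_list_decode Mu.prems(1)) simp_all
  then show ?case by simp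
qed

section \<open>Majorities on blocks\<close>

definition majority :: "nat set \<Rightarrow> nat set" where
  "majority C = {m. card (I_block m) < 2 * card (C \<inter> I_block m)}"

text \<open>Counting the block boundaries up to \<open>x\<close> gives the index of the block
  containing \<open>x\<close>, if \<open>x\<close> is positive; a bounded sum is visibly
  computable.\<close>

definition block_index :: "nat \<Rightarrow> nat" where
  "block_index x = (\<Sum>j<x. of_bool (fact (Suc j) \<le> x))"

lemma block_index_eq:
  assumes "x \<in> I_block m"
  shows "block_index x = m"
proof -
  from assms have x: "fact m \<le> x" "x < fact (Suc m)"
    by (simp_all add: I_block_def)
  have "{j. j < x \<and> fact (Suc j) \<le> x} = {..<m}"
  proof (intro set_eqI iffI)
    fix j assume "j \<in> {..<m}"
    then have "fact (Suc j) \<le> (fact m :: nat)" by (intro fact_mono) simp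
    moreover have "Suc j \<le> fact (Suc j)" by (rule fact_ge_self)
    ultimately show "j \<in> {j. j < x \<and> fact (Suc j) \<le> x}" using x(1) by (simp del: fact_Suc)
  next
    fix j assume j: "j \<in> {j. j < x \<and> fact (Suc j) \<le> x}"
    show "j \<in> {..<m}"
    proof (rule ccontr)
      assume "j \<notin> {..<m}"
      then have "fact (Suc m) \<le> (fact (Suc j) :: nat)" by (intro fact_mono) simp
      then show False using j x(2) by (simp del: fact_Suc)
    qed
  qed
  then show ?thesis
    by (simp add: block_index_def of_bool_def sum.If_cases Int_def del: fact_Suc)
qed

lemma block_index_mem:
  assumes "0 < x"
  shows "x \<in> I_block (block_index x)"
proof -
  define m where "m = (LEAST m. x < fact (Suc m))"
  have "Suc x \<le> fact (Suc x)" by (rule fact_ge_self)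
  then have "x < fact (Suc x)" by simp
  then have "x < fact (Suc m)" unfolding m_def by (rule LeastI)
  moreover have "fact m \<le> x"
  proof (cases m)
    case 0
    then show ?thesis using assms by simp
  next
    case (Suc k)
    then have "\<not> x < fact (Suc k)"
      using not_less_Least[of k "\<lambda>m. x < fact (Suc m)"] unfolding m_def by simp
    then show ?thesis using Suc by simp
  qed
  ultimately have "x \<in> I_block m" by (simp add: I_block_def)
  then show ?thesis using block_index_eq by simp
qed

lemma zero_notin_I_block: "0 \<notin> I_block m"
  by (simp add: I_block_def)

lemma mem_I_code_iff: "x \<in> I_code D \<longleftrightarrow> 0 < x \<and> block_index x \<in> D"
  using block_index_eq block_index_mem zero_notin_I_block
  unfolding I_code_def by (metis UN_iff gr0I)

lemma card_I_block: "card (I_block m) = m * fact m"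
  by (simp add: I_block_def)

text \<open>The block \<open>I_block m\<close> fills \<open>m / (m + 1)\<close> of the numbers below
  \<open>fact (Suc m)\<close>, hence at least two thirds of them for \<open>m \<ge> 2\<close>. Once
  the errors have density below \<open>1 / 3\<close> at this point, they are fewer than half of the
  block.\<close>

lemma majority_I_code:
  assumes "coarse_description C (I_code X)"
  shows "\<exists>N. \<forall>m\<ge>N. m \<in> majority C \<longleftrightarrow> m \<in> X"
proof -
  define S where "S = sym_diff C (I_code X)"
  have "(\<lambda>n. partial_density n S) \<longlonglongrightarrow> 0"
    using assms by (simp add: coarse_description_def has_density_def S_def)
  then have "\<forall>\<^sub>F n in sequentially. partial_density n S < 1 / 3"
    by (rule order_tendstoD) simp
  then obtain N where N: "\<And>n. n \<ge> N \<Longrightarrow> partial_density n S < 1 / 3"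
    by (auto simp: eventually_sequentially)
  have "m \<in> majority C \<longleftrightarrow> m \<in> X" if m: "max N 2 \<le> m" for m
  proof -
    define d where "d = card (S \<inter> I_block m)"
    have fin: "finite (I_block m)" by (simp add: I_block_def)
    have "Suc m \<le> fact (Suc m)" by (rule fact_ge_self)
    then have "partial_density (fact (Suc m)) S < 1 / 3"
      using m by (intro N) simp
    then have "real (3 * card (S \<inter> {0..<fact (Suc m)})) < real (fact (Suc m))"
      by (simp add: partial_density_def field_simps del: fact_Suc)
    then have "3 * card (S \<inter> {0..<fact (Suc m)}) < fact (Suc m)"
      by (simp only: of_nat_less_iff)
    moreover have "d \<le> card (S \<inter> {0..<fact (Suc m)})"
      unfolding d_def by (intro card_mono) (auto simp: I_block_def)
    ultimately have "6 * d < 2 * (Suc m * fact m)" by simp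
    also have "\<dots> \<le> 3 * (m * fact m)"
      using mult_le_mono1[of "2 * Suc m" "3 * m" "fact m"] m by (simp add: algebra_simps)
    finally have d: "2 * d < card (I_block m)"
      by (simp add: card_I_block)
    have code: "x \<in> I_code X \<longleftrightarrow> m \<in> X" if "x \<in> I_block m" for x
      using that block_index_eq[OF that] zero_notin_I_block[of m]
      by (metis mem_I_code_iff gr0I)
    show ?thesis
    proof (cases "m \<in> X")
      case True
      then have "C \<inter> I_block m = I_block m - (S \<inter> I_block m)"
        using code by (auto simp: S_def)
      then have "card (C \<inter> I_block m) = card (I_block m) - d"
        using fin by (simp add: d_def card_Diff_subset)
      then show ?thesis using d True by (simp add: majority_def)
    next
      case False
      then have "C \<inter> I_block m = S \<inter> I_block m"
        using code by (auto simp: S_def)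
      then show ?thesis using d False by (simp add: majority_def d_def)
    qed
  qed
  then show ?thesis by blast
qed

section \<open>Columns of the pairing\<close>

lemma pair_eq_iff:
  assumes "computable_pairing pair"
  shows "pair n i = pair n' i' \<longleftrightarrow> n = n' \<and> i = i'"
proof -
  have "inj (\<lambda>(n, i). pair n i)"
    using assms by (simp add: computable_pairing_def bij_is_inj)
  from inj_eq[OF this, of "(n, i)" "(n', i')"] show ?thesis by simp
qed

lemma mem_H_code_iff:
  assumes "computable_pairing pair"
  shows "pair n i \<in> H_code pair X \<longleftrightarrow> n \<in> X"
  by (auto simp: H_code_def pair_eq_iff[OF assms])

text \<open>The votes on \<open>C\<close> are wrong about \<open>H_code pair X\<close> only finitely
  often, and the injective map \<open>pair n\<close> leaves every finite set from some
  \<open>k\<close> on.\<close>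

lemma majority_E_code:
  assumes "computable_pairing pair" "coarse_description C (E_code pair X)"
  shows "\<exists>k. \<forall>i. pair n (k + i) \<in> majority C \<longleftrightarrow> n \<in> X"
proof -
  obtain N where N: "\<And>m. m \<ge> N \<Longrightarrow> m \<in> majority C \<longleftrightarrow> m \<in> H_code pair X"
    using majority_I_code assms(2) unfolding E_code_def by blast
  have "inj (pair n)"
    by (rule injI) (simp add: pair_eq_iff[OF assms(1)])
  then have "finite (pair n -` {..<N})"
    by (intro finite_vimageI) simp_all
  then obtain k where k: "\<forall>i\<in>pair n -` {..<N}. i < k"
    using finite_nat_set_iff_bounded by blast
  have "pair n (k + i) \<ge> N" for i
    using k[rule_format, of "k + i"] by (fastforce intro: leI)
  then show ?thesis
    using N mem_H_code_iff[OF assms(1)] by blast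
qed

section \<open>Sets of density zero\<close>

lemma has_density_finite:
  assumes "finite S"
  shows "has_density S 0"
  unfolding has_density_def
proof (rule tendsto_sandwich[where f = "\<lambda>_. 0" and h = "\<lambda>n. real (card S) / real n"])
  show "\<forall>\<^sub>F n in sequentially. partial_density n S \<le> real (card S) / real n"
    using assms by (auto simp: partial_density_def intro!: always_eventually divide_right_mono card_mono)
  show "(\<lambda>n. real (card S) / real n) \<longlonglongrightarrow> 0"
    by (rule lim_const_over_n)
qed (simp_all add: partial_density_def)

lemma coarse_description_refl: "coarse_description C C"
  using has_density_finite[of "{}"] by (simp add: coarse_description_def)

text \<open>Flipping bit \<open>n\<close> changes the code only on one finite block, so a uniform
  reduction given the flipped code must still answer for \<open>X\<close>.\<close>

lemma coarse_description_I_code_flip: "coarse_description (I_code (sym_diff X {n})) (I_code X)"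
proof -
  have "sym_diff (I_code (sym_diff X {n})) (I_code X) \<subseteq> I_block n"
    by (auto simp: I_code_def)
  moreover have "finite (I_block n)"
    by (simp add: I_block_def)
  ultimately show ?thesis
    unfolding coarse_description_def by (intro has_density_finite) (rule finite_subset)
qed


section \<open>Programs for the coding operators\<close>

lemma ucomp_computes:
  assumes "ucomp 1 (\<lambda>A e. of_bool (P A (e 0)))" "\<And>A x. x \<in> F A \<longleftrightarrow> P A x"
  shows "\<exists>p. \<forall>A. computes p A (F A)"
proof -
  obtain p where "\<And>A xs. length xs = 1 \<Longrightarrow> eval A p xs = Some (of_bool (P A (xs ! 0)))"
    using ucomp_program[OF assms(1)] by metis
  then have "computes p A (F A)" for A
    by (simp add: computes_def assms(2))
  then show ?thesis by blast
qed

lemma majority_program: "\<exists>p. \<forall>A. computes p A (majority A)"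
proof -
  have card: "card (A \<inter> I_block m) = (\<Sum>j<fact (Suc m). of_bool (fact m \<le> j \<and> j \<in> A))" for A m
  proof -
    have "A \<inter> I_block m = {j. j < fact (Suc m) \<and> fact m \<le> j \<and> j \<in> A}"
      by (auto simp: I_block_def)
    then show ?thesis
      by (simp add: of_bool_def sum.If_cases Int_def del: fact_Suc)
  qed
  have "ucomp 1 (\<lambda>A e. of_bool (e 0 * fact (e 0)
      < 2 * (\<Sum>j<fact (Suc (e 0)). of_bool (fact (e 0) \<le> j \<and> j \<in> A))))"
    by (intro ucomp_intros) simp_all
  from ucomp_computes[OF this, of majority] show ?thesis
    by (simp only: majority_def card card_I_block mem_Collect_eq)
qed

lemma I_code_program: "\<exists>p. \<forall>A. computes p A (I_code A)"
proof -
  have index: "ucomp k (\<lambda>A e. block_index (g A e))" if "ucomp k g" for k g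
  proof (rule ucomp_lift[OF _ that])
    show "ucomp 1 (\<lambda>A e. block_index (e 0))"
      unfolding block_index_def by (intro ucomp_intros) simp_all
  qed
  have "ucomp 1 (\<lambda>A e. of_bool (0 < e 0 \<and> block_index (e 0) \<in> A))"
    by (intro ucomp_intros index) simp_all
  from ucomp_computes[OF this, of I_code] show ?thesis
    by (simp only: mem_I_code_iff)
qed

text \<open>The pairing is given by a program for the empty oracle; answering its queries by
  \<open>Zero\<close> makes it work with every oracle.\<close>

lemma ucomp_pair:
  assumes "computable_pairing pair" "ucomp k g" "ucomp k h"
  shows "ucomp k (\<lambda>A e. pair (g A e) (h A e))"
proof -
  obtain p where "\<And>n i. eval {} p [n, i] = Some (pair n i)"
    using assms(1) unfolding computable_pairing_def by blast
  then have "eval A (subst_oracle Zero p) [n, i] = Some (pair n i)" for A n i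
    by (simp add: eval_subst_oracle[OF computes_empty])
  from ucomp_call2[OF this assms(2,3)] show ?thesis .
qed

text \<open>The inverse of the pairing is found by search through the Cantor codes \<open>v\<close>
  of pairs. Surjectivity ends the search.\<close>

lemma H_code_program:
  assumes "computable_pairing pair"
  shows "\<exists>p. \<forall>A. computes p A (H_code pair A)"
proof -
  let ?P = "\<lambda>v m. pair (fst (prod_decode v)) (snd (prod_decode v)) = m"
  have ex: "\<exists>v. ?P v m" for m
  proof -
    have "surj (\<lambda>(n, i). pair n i)"
      using assms by (simp add: computable_pairing_def bij_is_surj)
    then obtain n i where "m = pair n i"
      by (metis case_prod_conv surj_def surj_pair)
    then have "?P (prod_encode (n, i)) m" by simp
    then show ?thesis by blast
  qed
  \<comment> \<open>The double negation matches the form of \<open>ucomp_Least\<close>, which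
    searches for a failure.\<close>
  have "ucomp 1 (\<lambda>A e. LEAST v. \<not> \<not> ?P v (e 0))"
    using ex by (intro ucomp_Least ucomp_intros ucomp_pair[OF assms]) simp_all
  then have "ucomp 1 (\<lambda>A e. LEAST v. ?P v (e 0))"
    by simp
  then have "ucomp 1 (\<lambda>A e. of_bool (fst (prod_decode (LEAST v. ?P v (e 0))) \<in> A))"
    by (intro ucomp_intros)
  moreover have "m \<in> H_code pair A \<longleftrightarrow> fst (prod_decode (LEAST v. ?P v m)) \<in> A" for A m
  proof -
    define v where "v = (LEAST v. ?P v m)"
    have "?P v m" unfolding v_def using ex by (rule LeastI_ex)
    then show ?thesis
      unfolding v_def[symmetric]
      using mem_H_code_iff[OF assms, of "fst (prod_decode v)" "snd (prod_decode v)" A] by (simp only:)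
  qed
  ultimately show ?thesis by (rule ucomp_computes)
qed

lemma sym_diff_sym_diff: "sym_diff (sym_diff A B) B = A"
  by auto

lemma flip_program: "\<exists>p. \<forall>A. computes p A (sym_diff A {n})"
proof -
  have "ucomp 1 (\<lambda>A e. of_bool (\<not> (e 0 \<in> A \<longleftrightarrow> e 0 = n)))"
    by (intro ucomp_intros) simp_all
  then show ?thesis
    by (rule ucomp_computes) auto
qed

text \<open>One flip program is composed for each element of the finite difference, so the program
  depends on that difference.\<close>

lemma computes_finite_change:
  assumes "computes p A B" "finite (sym_diff B C)"
  shows "\<exists>q. computes q A C"
proof -
  have "\<exists>q. computes q A (sym_diff B F)" if "finite F" for F
    using that
  proof (induction F)
    case empty
    then show ?case using assms(1) by auto
  next
    case (insert n F)
    then obtain q where q: "computes q A (sym_diff B F)" by blast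
    obtain r where "\<And>A. computes r A (sym_diff A {n})" using flip_program by blast
    from computes_subst_oracle[OF q this]
    have "computes (subst_oracle q r) A (sym_diff (sym_diff B F) {n})" .
    moreover have "sym_diff (sym_diff B F) {n} = sym_diff B (insert n F)"
      using insert.hyps by auto
    ultimately show ?case by auto
  qed
  \<comment> \<open>The flipped set is the difference itself:
    \<open>sym_diff B (sym_diff B C) = C\<close>.\<close>
  from this[OF assms(2)] show ?thesis
    by (metis sym_diff_sym_diff Un_commute)
qed

section \<open>The nonuniform reduction\<close>

lemma E_code_nc_le_I_code:
  assumes "computable_pairing pair"
  shows "E_code pair X \<le>\<^sub>n\<^sub>c I_code X"
  unfolding nc_le_def
proof (intro allI impI)
  fix D assume D: "coarse_description D (I_code X)"
  obtain M where M: "\<And>A. computes M A (majority A)" using majority_program by blast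
  obtain h where h: "\<And>A. computes h A (H_code pair A)" using H_code_program[OF assms] by blast
  obtain i where i: "\<And>A. computes i A (I_code A)" using I_code_program by blast
  obtain N where "\<And>m. m \<ge> N \<Longrightarrow> m \<in> majority D \<longleftrightarrow> m \<in> X"
    using majority_I_code[OF D] by blast
  then have "sym_diff (majority D) X \<subseteq> {..<N}"
    by (auto simp: not_le[symmetric])
  \<comment> \<open>The nonuniform step: \<open>q\<close> has the finitely many wrong votes of
    \<open>D\<close> built in.\<close>
  then obtain q where "computes q D X"
    using computes_finite_change[OF M] finite_subset by blast
  then have "computes (subst_oracle (subst_oracle q h) i) D (E_code pair X)"
    unfolding E_code_def using h i by (blast intro: computes_subst_oracle)
  then show "\<exists>\<Phi> C. computes \<Phi> D C \<and> coarse_description C (E_code pair X)"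
    using coarse_description_refl by blast
qed


section \<open>Forcing with finite strings\<close>

lemma length_initial_segment [simp]: "length (initial_segment D l) = l"
  by (simp add: initial_segment_def)

lemma initial_segment_eq_iff: "initial_segment D l = \<tau> \<longleftrightarrow> length \<tau> = l \<and> (\<forall>x<l. x \<in> D \<longleftrightarrow> \<tau> ! x)"
  by (auto simp: initial_segment_def list_eq_iff_nth_eq)

lemma prefix_initial_segment:
  assumes "initial_segment D n = \<sigma>" "n \<le> l"
  shows "prefix \<sigma> (initial_segment D l)"
proof -
  have "[0..<l] = [0..<n] @ [n..<l]"
    using assms(2) upt_add_eq_append[of 0 n "l - n"] by simp
  then show ?thesis
    unfolding assms(1)[symmetric] initial_segment_def by simp
qed

abbreviation approx_code :: "nat \<Rightarrow> prog \<Rightarrow> nat list \<Rightarrow> nat" where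
  "approx_code c \<equiv> approx (length (list_decode c)) (code_set c)"

lemma approx_code_initial_segment:
  "approx_code (string_code (initial_segment D l)) p xs = approx l D p xs"
  by (simp, rule approx_cong) (simp add: initial_segment_def)

lemma approx_code_sound:
  assumes "approx_code (string_code \<tau>) p xs = Suc v" "initial_segment D (length \<tau>) = \<tau>"
  shows "eval D p xs = Some v"
proof -
  have "approx (length \<tau>) D p xs = Suc v"
    using assms approx_code_initial_segment[of D "length \<tau>"] by simp
  then show ?thesis by (rule approx_sound[rotated]) simp
qed

lemma Sigma02_ucomp:
  assumes "ucomp 3 (\<lambda>A e. of_bool (R (e 0) (e 1) (e 2)))"
  shows "Sigma02 {\<tau>. \<exists>a. \<forall>b. R (string_code \<tau>) a b}"
proof -
  obtain p where "\<And>A xs. length xs = 3 \<Longrightarrow> eval A p xs = Some (of_bool (R (xs ! 0) (xs ! 1) (xs ! 2)))"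
    using ucomp_program[OF assms] by metis
  then have "computable_matrix (\<lambda>\<tau>. R (string_code \<tau>))"
    unfolding computable_matrix_def by (intro exI[of _ p]) simp
  then show ?thesis
    unfolding Sigma02_def by blast
qed

text \<open>The strings on which a truncated run of \<open>p\<close> returns 0 form a set that
  \<open>X\<close> avoids by soundness. Genericity gives an initial segment of \<open>X\<close>
  without extension in this set, and by completeness no oracle extending that segment can make
  \<open>p\<close> return 0.\<close>

lemma generic_forces:
  assumes "two_generic X" "\<And>b. eval X p [b] \<noteq> Some 0"
  obtains l where "\<And>D b. initial_segment D l = initial_segment X l \<Longrightarrow> eval D p [b] \<noteq> Some 0"
proof -
  \<comment> \<open>The dummy quantifier over \<open>b\<close> gives the set the shape required by
    \<open>Sigma02\<close>.\<close>
  let ?T = "{\<tau>. \<exists>a. \<forall>b::nat. approx_code (string_code \<tau>) p [a] = 1}"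
  have "ucomp 3 (\<lambda>A e. approx_code (e 0) p (map (\<lambda>g. g A e) [\<lambda>A e. e 1]))"
    by (intro ucomp_approx) (simp_all add: ucomp_var)
  then have "ucomp 3 (\<lambda>A e. of_bool (approx_code (e 0) p [e 1] = 1))"
    by (intro ucomp_eq ucomp_const) simp
  then have "Sigma02 ?T"
    by (rule Sigma02_ucomp[of "\<lambda>s a b. approx_code s p [a] = 1"])
  moreover have "initial_segment X n \<notin> ?T" for n
    using approx_code_sound[of "initial_segment X n" p _ 0 X] assms(2) by auto
  ultimately obtain l where l: "\<And>\<tau>. prefix (initial_segment X l) \<tau> \<Longrightarrow> \<tau> \<notin> ?T"
    using assms(1) unfolding two_generic_def by blast
  have "eval D p [b] \<noteq> Some 0" if D: "initial_segment D l = initial_segment X l" for D b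
  proof
    assume "eval D p [b] = Some 0"
    from approx_complete[OF this] obtain L where "\<And>L'. L' \<ge> L \<Longrightarrow> approx L' D p [b] = 1"
      by (auto simp: eventually_sequentially)
    \<comment> \<open>This length suffices both to extend the forcing segment and for the truncated
      run to converge.\<close>
    then have "initial_segment D (max l L) \<in> ?T"
      unfolding mem_Collect_eq approx_code_initial_segment by (metis max.cobounded2)
    moreover have "prefix (initial_segment X l) (initial_segment D (max l L))"
      by (rule prefix_initial_segment[OF D]) simp
    ultimately show False using l by blast
  qed
  then show thesis by (rule that)
qed

text \<open>A run returning 0 depends on a finite part of its oracle, so the quantifier over sets
  \<open>D\<close> reduces to one over finite extensions of the string. Merged with the input, this
  is a single universal number quantifier.\<close>

lemma Sigma02_forces:
  "Sigma02 {\<tau>. \<exists>a. \<forall>D. initial_segment D (length \<tau>) = \<tau> \<longrightarrow> (\<forall>b. eval D q [a, b] \<noteq> Some 0)}"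
proof -
  \<comment> \<open>\<open>b\<close> packs an input and the code of a finite oracle;
    \<open>R\<close> says that they do not refute the forcing statement.\<close>
  define R where "R s a b \<longleftrightarrow> \<not> (length (list_decode s) \<le> length (list_decode (snd (prod_decode b))) \<and>
      (\<forall>x<length (list_decode s). x \<in> code_set (snd (prod_decode b)) \<longleftrightarrow> x \<in> code_set s) \<and>
      approx_code (snd (prod_decode b)) q [a, fst (prod_decode b)] = 1)" for s a b
  have "ucomp 3 (\<lambda>A e. approx_code (snd (prod_decode (e 2))) q
      (map (\<lambda>g. g A e) [\<lambda>A e. e 1, \<lambda>A e. fst (prod_decode (e 2))]))"
    by (intro ucomp_approx) (simp_all add: ucomp_intros)
  then have approx: "ucomp 3 (\<lambda>A e. approx_code (snd (prod_decode (e 2))) q [e 1, fst (prod_decode (e 2))])"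
    by simp
  have "ucomp 3 (\<lambda>A e. of_bool (R (e 0) (e 1) (e 2)))"
    unfolding R_def by (intro ucomp_intros approx) simp_all
  then have "Sigma02 {\<tau>. \<exists>a. \<forall>b. R (string_code \<tau>) a b}"
    by (rule Sigma02_ucomp)
  moreover have "(\<forall>b. R (string_code \<tau>) a b) \<longleftrightarrow>
      (\<forall>D. initial_segment D (length \<tau>) = \<tau> \<longrightarrow> (\<forall>b. eval D q [a, b] \<noteq> Some 0))" for \<tau> a
  proof (intro iffI allI impI notI)
    fix D b
    assume R: "\<forall>b. R (string_code \<tau>) a b" and D: "initial_segment D (length \<tau>) = \<tau>"
      and "eval D q [a, b] = Some 0"
    from approx_complete[OF this(3)] obtain L where L: "\<And>L'. L' \<ge> L \<Longrightarrow> approx L' D q [a, b] = 1"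
      by (auto simp: eventually_sequentially)
    define l where "l = max L (length \<tau>)"
    have "\<not> R (string_code \<tau>) a (prod_encode (b, string_code (initial_segment D l)))"
      using D L[of l] unfolding R_def initial_segment_eq_iff
      by (auto simp: approx_code_initial_segment[simplified] l_def)
        (auto simp: initial_segment_def)
    then show False using R by blast
  next
    fix b
    assume R: "\<forall>D. initial_segment D (length \<tau>) = \<tau> \<longrightarrow> (\<forall>b. eval D q [a, b] \<noteq> Some 0)"
    show "R (string_code \<tau>) a b"
    proof (rule ccontr)
      assume "\<not> R (string_code \<tau>) a b"
      then have "\<forall>x<length \<tau>. x \<in> code_set (snd (prod_decode b)) \<longleftrightarrow> \<tau> ! x"
        and "approx_code (snd (prod_decode b)) q [a, fst (prod_decode b)] = Suc 0"
        unfolding R_def by auto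
      \<comment> \<open>The packed code need not come from a Boolean string, so its
        \<open>code_set\<close> is taken as the oracle \<open>D\<close>.\<close>
      then have "initial_segment (code_set (snd (prod_decode b))) (length \<tau>) = \<tau>"
        and "eval (code_set (snd (prod_decode b))) q [a, fst (prod_decode b)] = Some 0"
        using approx_sound by (auto simp: initial_segment_eq_iff)
      then show False using R by blast
    qed
  qed
  ultimately show ?thesis by simp
qed

text \<open>The program \<open>q\<close> returns \<open>0\<close> when the majority vote with oracle \<open>D\<close> equals the \<open>n\<close>-th bit of \<open>D\<close>.\<close>

lemma limit_guess_program:
  assumes "computable_pairing pair"
  obtains q where "\<And>D C n k i. computes \<Phi> (I_code D) C \<Longrightarrow>
    eval D q [prod_encode (n, k), i] = Some (of_bool (pair n (k + i) \<in> majority C \<longleftrightarrow> n \<notin> D))"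
proof -
  obtain M where M: "\<And>A. computes M A (majority A)" using majority_program by blast
  obtain c where c: "\<And>A. computes c A (I_code A)" using I_code_program by blast
  define g where "g = subst_oracle (subst_oracle c \<Phi>) M"
  have g: "computes g D (majority C)" if "computes \<Phi> (I_code D) C" for D C
    unfolding g_def using that c M by (blast intro: computes_subst_oracle)
  have "ucomp 2 (\<lambda>A e. fst (prod_decode (e 0)))"
    by (intro ucomp_intros) simp
  from ucomp_program[OF this] obtain f where
    f: "\<And>A xs. length xs = 2 \<Longrightarrow> eval A f xs = Some (fst (prod_decode (xs ! 0)))"
    by metis
  \<comment> \<open>The first argument packs \<open>n\<close> with the starting point
    \<open>k\<close>, so that \<open>Sigma02_forces\<close> has one number to quantify
    existentially.\<close>
  have "ucomp 2 (\<lambda>A e. pair (fst (prod_decode (e 0))) (snd (prod_decode (e 0)) + e 1))"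
    by (intro ucomp_intros ucomp_pair[OF assms]) simp_all
  from ucomp_program[OF this] obtain h where
    h: "\<And>A xs. length xs = 2 \<Longrightarrow>
      eval A h xs = Some (pair (fst (prod_decode (xs ! 0))) (snd (prod_decode (xs ! 0)) + xs ! 1))"
    by metis
  have "ucomp 2 (\<lambda>A e. of_bool (\<not> e 0 = e 1))"
    by (intro ucomp_intros) simp_all
  from ucomp_program[OF this] obtain r where
    r: "\<And>A xs. length xs = 2 \<Longrightarrow> eval A r xs = Some (of_bool (\<not> xs ! 0 = xs ! 1))"
    by metis
  show thesis
  proof (rule that)
    fix D C n k i assume "computes \<Phi> (I_code D) C"
    from g[OF this] show "eval D (Comp r [Comp g [h], Comp Oracle [f]]) [prod_encode (n, k), i]
      = Some (of_bool (pair n (k + i) \<in> majority C \<longleftrightarrow> n \<notin> D))"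
      by (simp add: f h r computes_def)
  qed
qed

section \<open>Failure of the uniform reduction\<close>

lemma not_E_code_uc_le_I_code:
  assumes pair: "computable_pairing pair" and X: "two_generic X"
  shows "\<not> E_code pair X \<le>\<^sub>u\<^sub>c I_code X"
proof
  assume "E_code pair X \<le>\<^sub>u\<^sub>c I_code X"
  then obtain \<Phi> where \<Phi>: "\<And>D. coarse_description D (I_code X) \<Longrightarrow>
      \<exists>C. computes \<Phi> D C \<and> coarse_description C (E_code pair X)"
    unfolding uc_le_def by blast
  obtain q where q: "\<And>D C n k i. computes \<Phi> (I_code D) C \<Longrightarrow>
      eval D q [prod_encode (n, k), i] = Some (of_bool (pair n (k + i) \<in> majority C \<longleftrightarrow> n \<notin> D))"
    using limit_guess_program[OF pair] by metis
  define S where "S = {\<tau>. \<exists>a. \<forall>D. initial_segment D (length \<tau>) = \<tau> \<longrightarrow> (\<forall>b. eval D q [a, b] \<noteq> Some 0)}"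
  have flip: "\<exists>l>n. initial_segment (sym_diff X {n}) l \<in> S" for n
  proof -
    obtain f where f: "\<And>A. computes f A (sym_diff A {n})" using flip_program by blast
    obtain C where C: "computes \<Phi> (I_code (sym_diff X {n})) C" "coarse_description C (E_code pair X)"
      using \<Phi>[OF coarse_description_I_code_flip] by blast
    from majority_E_code[OF pair C(2), of n] obtain k where
      k: "\<And>i. pair n (k + i) \<in> majority C \<longleftrightarrow> n \<in> X"
      by blast
    let ?a = "prod_encode (n, k)"
    obtain c where c: "\<And>A xs. length xs = 1 \<Longrightarrow> eval A c xs = Some ?a"
      using ucomp_program[OF ucomp_const[of 1 ?a]] by metis
    \<comment> \<open>\<open>?p\<close> flips bit \<open>n\<close> of its oracle before running
      \<open>q\<close>, so that genericity of \<open>X\<close> itself applies to runs on the flipped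
      set.\<close>
    let ?p = "Comp (subst_oracle f q) [c, Proj 0]"
    have p: "eval D ?p [b] = eval (sym_diff D {n}) q [?a, b]" for D b
      by (simp add: c eval_subst_oracle[OF f])
    have "eval X ?p [b] \<noteq> Some 0" for b
      unfolding p q[OF C(1)] k by simp
    from generic_forces[OF X this] obtain l where
      l: "\<And>D b. initial_segment D l = initial_segment X l \<Longrightarrow> eval D ?p [b] \<noteq> Some 0"
      by metis
    \<comment> \<open>The bound \<open>Suc n\<close> ensures that the segment of the flipped set
      extends the first \<open>n\<close> bits of \<open>X\<close>.\<close>
    define l' where "l' = max l (Suc n)"
    have "eval D q [?a, b] \<noteq> Some 0"
      if "initial_segment D l' = initial_segment (sym_diff X {n}) l'" for D b
    proof -
      have "initial_segment (sym_diff D {n}) l = initial_segment X l"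
        using that by (auto simp: initial_segment_def l'_def)
      from l[OF this, of b] show ?thesis
        unfolding p by (simp add: sym_diff_sym_diff)
    qed
    then have "initial_segment (sym_diff X {n}) l' \<in> S"
      by (auto simp: S_def)
    moreover have "n < l'" by (simp add: l'_def)
    ultimately show ?thesis by blast
  qed
  \<comment> \<open>The flip at \<open>n\<close> leaves the first \<open>n\<close> bits unchanged,
    and \<open>n\<close> is arbitrary: no initial segment of \<open>X\<close> can exclude
    \<open>S\<close>.\<close>
  have "\<exists>\<tau>. prefix (initial_segment X n) \<tau> \<and> \<tau> \<in> S" for n
  proof -
    obtain l where l: "l > n" "initial_segment (sym_diff X {n}) l \<in> S"
      using flip by blast
    have "initial_segment (sym_diff X {n}) n = initial_segment X n"
      by (auto simp: initial_segment_def)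
    then have "prefix (initial_segment X n) (initial_segment (sym_diff X {n}) l)"
      using l(1) by (intro prefix_initial_segment less_imp_le)
    with l(2) show ?thesis by blast
  qed
  moreover have "Sigma02 S"
    unfolding S_def by (rule Sigma02_forces)
  ultimately obtain m where "initial_segment X m \<in> S"
    using X unfolding two_generic_def by blast
  then obtain a where "\<And>b. eval X q [a, b] \<noteq> Some 0"
    by (auto simp: S_def)
  moreover obtain n k where "a = prod_encode (n, k)"
    by (metis prod_decode_inverse surj_pair)
  moreover obtain C where C: "computes \<Phi> (I_code X) C" "coarse_description C (E_code pair X)"
    using \<Phi>[OF coarse_description_refl] by blast
  ultimately have no: "pair n (k + i) \<in> majority C \<longleftrightarrow> n \<notin> X" for i
    using q[OF C(1), of n k i] by (auto simp: of_bool_def split: if_splits)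
  from majority_E_code[OF pair C(2), of n] obtain j where
    "\<And>i. pair n (j + i) \<in> majority C \<longleftrightarrow> n \<in> X"
    by blast
  \<comment> \<open>The votes are wrong from \<open>k\<close> on and right from \<open>j\<close> on;
    the entry \<open>k + j\<close> of column \<open>n\<close> lies in both ranges.\<close>
  from this[of k] no[of j] show False
    by (simp add: add.commute)
qed

theorem corollary2p8:
  fixes pair :: "nat \<Rightarrow> nat \<Rightarrow> nat" and X :: "nat set"
  assumes "computable_pairing pair"
    and "two_generic X"
  shows "E_code pair X \<le>\<^sub>n\<^sub>c I_code X \<and> \<not> E_code pair X \<le>\<^sub>u\<^sub>c I_code X"
  using E_code_nc_le_I_code[OF assms(1)] not_E_code_uc_le_I_code[OF assms] by (rule conjI)

end
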